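(* Let $n\in\mathbb N$, and let $T\in\mathbb{B}(\mathcal H)$ be an $n$-power quasinormal operator. Let $$T=\begin{bmatrix}\widetilde{T}&X\\0&N\end{bmatrix}$$ be the matrix representation of $T$ with respect to $\mathcal{H}=\overline{\operatorname{ran}T^n}\oplus\ker (T^\ast)^n$. Then the following conditions are equivalent: (i) $\overline{\operatorname{ran}T^n}=\overline{\operatorname{ran}T^{n+1}}$. (ii) $\ker (T^\ast)^n\subseteq\ker T^n$. (iii) $P_{\overline{\operatorname{ran}T^n}}T\big|_{\ker (T^\ast)^n}=0$ (that is, $X=0$). (iv) $T=\widetilde T\oplus N$; moreover, $\widetilde T$ is an $n$-power normal quasiaffinity. (v) $T^n$ is normal.
   Context: $\mathbb{N}$ denotes the positive integers. $\mathbb{B}(\mathcal{H})$ is the algebra of bounded linear operators on a complex Hilbert space $\mathcal{H}$. $\operatorname{ran}$, $\ker$ denote range and null space, $\overline{A}$ the closure of $A$, and $P_M$ the orthogonal projection onto a closed subspace $M$. Write $[S,T]=ST-TS$. $T$ is $n$-power quasinormal if $[T^n,T^*T]=0$; $T$ is $n$-power normal if $[T^n,T^*]=0$; an operator is normal if it commutes with its adjoint. An operator is a quasiaffinity if it is injective and has dense range. In the block matrix, $\widetilde T=T|_{\overline{\operatorname{ran}T^n}}$ as an operator on $\overline{\operatorname{ran}T^n}$ (which is $T$-invariant), $X=P_{\overline{\operatorname{ran}T^n}}T|_{\ker(T^* )^n}$, and $N=P_{\ker(T^* )^n}T|_{\ker(T^* )^n}$. For $n$-power quasinormal $T$, one has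 that $\widetilde T$ is injective and $n$-power quasinormal, $\widetilde T^*X=0$ and $N^n=0$. *)

theory Defs
  imports "HOL-Analysis.Analysis"
begin

text \<open>Complex Hilbert spaces. The inner product is linear in its first argument. Nonnegativity and
  definiteness of the form follow from the axiom relating it to the norm, and completeness is part
  of class \<^class>\<open>banach\<close>.\<close>

class complex_hilbert_space = banach +
  fixes scaleC :: "complex \<Rightarrow> 'a \<Rightarrow> 'a"  (infixr \<open>*\<^sub>C\<close> 75)
    and cinner :: "'a \<Rightarrow> 'a \<Rightarrow> complex"
  assumes scaleC_of_real: "complex_of_real r *\<^sub>C x = r *\<^sub>R x"
    and scaleC_add_right: "c *\<^sub>C (x + y) = c *\<^sub>C x + c *\<^sub>C y"
    and scaleC_add_left: "(c + d) *\<^sub>C x = c *\<^sub>C x + d *\<^sub>C x"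
    and scaleC_scaleC: "c *\<^sub>C d *\<^sub>C x = (c * d) *\<^sub>C x"
    and cinner_commute: "cinner x y = cnj (cinner y x)"
    and cinner_add_left: "cinner (x + y) z = cinner x z + cinner y z"
    and cinner_scaleC_left: "cinner (c *\<^sub>C x) y = c * cinner x y"
    and norm_eq_sqrt_cinner: "norm x = sqrt (Re (cinner x x))"

instantiation complex :: complex_hilbert_space
begin

definition scaleC_complex_def: "c *\<^sub>C x = c * (x :: complex)"
definition cinner_complex_def: "cinner x y = x * cnj (y :: complex)"

instance
  by standard
    (auto simp: scaleC_complex_def cinner_complex_def algebra_simps scaleR_conv_of_real
      cmod_def power2_eq_square)

end

definition bounded_clinear :: "('a::complex_hilbert_space \<Rightarrow> 'a) \<Rightarrow> bool" where
  "bounded_clinear T \<longleftrightarrow> bounded_linear T \<and> (\<forall>c x. T (c *\<^sub>C x) = c *\<^sub>C T x)"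

definition ker :: "('a::complex_hilbert_space \<Rightarrow> 'a) \<Rightarrow> 'a set" where
  "ker T = {x. T x = 0}"

text \<open>The orthogonal projection onto a closed subspace \<open>M\<close>.\<close>

definition orth_proj :: "'a::complex_hilbert_space set \<Rightarrow> 'a \<Rightarrow> 'a" where
  "orth_proj M x = (THE y. y \<in> M \<and> (\<forall>z\<in>M. cinner (x - y) z = 0))"

text \<open>A closed subspace \<open>M\<close> is a Hilbert space in its own right. An operator on \<open>M\<close> is
  represented by a function whose values outside \<open>M\<close> are irrelevant, and the notions below, in
  particular the adjoint, are those of the Hilbert space \<open>M\<close>. The whole space is the case
  \<open>M = UNIV\<close>.\<close>

definition adjoint_on :: "'a::complex_hilbert_space set \<Rightarrow> ('a \<Rightarrow> 'a) \<Rightarrow> 'a \<Rightarrow> 'a" where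
  "adjoint_on M T = (\<lambda>y\<in>M. THE z. z \<in> M \<and> (\<forall>x\<in>M. cinner (T x) y = cinner x z))"

definition commutator :: "('a::complex_hilbert_space \<Rightarrow> 'a) \<Rightarrow> ('a \<Rightarrow> 'a) \<Rightarrow> 'a \<Rightarrow> 'a" where
  "commutator S T x = S (T x) - T (S x)"

definition power_quasinormal_on :: "'a::complex_hilbert_space set \<Rightarrow> nat \<Rightarrow> ('a \<Rightarrow> 'a) \<Rightarrow> bool" where
  "power_quasinormal_on M n T \<longleftrightarrow> (\<forall>x\<in>M. commutator (T ^^ n) (adjoint_on M T \<circ> T) x = 0)"

definition power_normal_on :: "'a::complex_hilbert_space set \<Rightarrow> nat \<Rightarrow> ('a \<Rightarrow> 'a) \<Rightarrow> bool" where
  "power_normal_on M n T \<longleftrightarrow> (\<forall>x\<in>M. commutator (T ^^ n) (adjoint_on M T) x = 0)"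

definition normal_on :: "'a::complex_hilbert_space set \<Rightarrow> ('a \<Rightarrow> 'a) \<Rightarrow> bool" where
  "normal_on M T \<longleftrightarrow> (\<forall>x\<in>M. commutator T (adjoint_on M T) x = 0)"

definition quasiaffinity_on :: "'a::complex_hilbert_space set \<Rightarrow> ('a \<Rightarrow> 'a) \<Rightarrow> bool" where
  "quasiaffinity_on M T \<longleftrightarrow> inj_on T M \<and> closure (T ` M) = M"

abbreviation adjoint_op :: "('a::complex_hilbert_space \<Rightarrow> 'a) \<Rightarrow> 'a \<Rightarrow> 'a" where
  "adjoint_op \<equiv> adjoint_on UNIV"

abbreviation power_quasinormal :: "nat \<Rightarrow> ('a::complex_hilbert_space \<Rightarrow> 'a) \<Rightarrow> bool" where
  "power_quasinormal \<equiv> power_quasinormal_on UNIV"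

abbreviation normal_op :: "('a::complex_hilbert_space \<Rightarrow> 'a) \<Rightarrow> bool" where
  "normal_op \<equiv> normal_on UNIV"

text \<open>\<open>block_op M L A B C D\<close> is the operator with block matrix \<open>A, B\<close> (first row) and \<open>C, D\<close>
  (second row) with respect to the orthogonal decomposition of the space into \<open>M\<close> and \<open>L\<close>.\<close>

definition block_op ::
  "'a::complex_hilbert_space set \<Rightarrow> 'a set \<Rightarrow> ('a \<Rightarrow> 'a) \<Rightarrow> ('a \<Rightarrow> 'a) \<Rightarrow> ('a \<Rightarrow> 'a) \<Rightarrow> ('a \<Rightarrow> 'a)
    \<Rightarrow> 'a \<Rightarrow> 'a" where
  "block_op M L A B C D x =
    (A (orth_proj M x) + B (orth_proj L x)) + (C (orth_proj M x) + D (orth_proj L x))"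

definition direct_sum_op ::
  "'a::complex_hilbert_space set \<Rightarrow> 'a set \<Rightarrow> ('a \<Rightarrow> 'a) \<Rightarrow> ('a \<Rightarrow> 'a) \<Rightarrow> 'a \<Rightarrow> 'a" where
  "direct_sum_op M L A D x = A (orth_proj M x) + D (orth_proj L x)"

end

theory Submission
  imports Defs
begin

text \<open>Write \<open>A\<close> for the adjoint of \<open>T\<close>, \<open>M\<close> for the closure of the range of \<open>T\<^sup>n\<close>, and \<open>L\<close> for
  \<open>ker A\<^sup>n\<close>, which is the orthogonal complement of \<open>M\<close>. The subspace \<open>M\<close> is invariant under \<open>T\<close>, and
  the off-diagonal block \<open>X\<close> vanishes exactly when \<open>L\<close> is invariant too, that is, when \<open>M\<close> reduces
  \<open>T\<close>. Each of the five conditions is shown to be equivalent to this invariance of \<open>L\<close>.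

  Three facts carry the argument, all consequences of \<open>T\<^sup>n\<close> commuting with \<open>A T\<close>. The kernel of \<open>T\<close>,
  which is also that of \<open>A T\<close>, is contained in \<open>L\<close> (\<open>ker_T_subset_L\<close>), so \<open>T\<close> is injective on \<open>M\<close>.
  The range of \<open>X\<close> is orthogonal to \<open>T M\<close> (\<open>off_diagonal_orthogonal\<close>). And \<open>T\<^sup>n A = A T\<^sup>n\<close> holds on
  the range of \<open>T\<close>, hence on \<open>M\<close> by continuity (\<open>Tn_A_commute_M\<close>).

  If the ranges of \<open>T\<^sup>n\<close> and \<open>T\<^bsup>n+1\<^esup>\<close> have the same closure, then \<open>T M\<close> is dense in \<open>M\<close>, so
  \<open>X = 0\<close>. If \<open>T\<^sup>n\<close> vanishes on \<open>L\<close>, then for \<open>y\<close> in \<open>L\<close> it vanishes on \<open>T y\<close> and on the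
  \<open>L\<close>-component of \<open>T y\<close>, hence on \<open>X y\<close>, and injectivity on \<open>M\<close> gives \<open>X y = 0\<close>. Normality of \<open>T\<^sup>n\<close>
  makes its kernel equal to \<open>L\<close>, which is the previous case. Conversely, when \<open>M\<close> reduces \<open>T\<close>,
  \<open>T\<^sup>n\<close> maps \<open>L\<close> into \<open>L \<inter> M = {0}\<close>, and \<open>A\<close> restricts to the adjoint of \<open>T\<close> on \<open>M\<close>, where it
  commutes with \<open>T\<^sup>n\<close>; all the remaining conditions follow.

  The required Hilbert space theory, namely orthogonal projections, Riesz representation and adjoints,
  is developed from the inner product axioms.\<close>

section \<open>The inner product\<close>

lemma cinner_add_right: "cinner x (y + z) = cinner x y + cinner x z"
  using cinner_commute[of x "y + z"] cinner_commute[of x y] cinner_commute[of x z]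
  by (simp add: cinner_add_left)

lemma cinner_scaleC_right: "cinner x (c *\<^sub>C y) = cnj c * cinner x y"
  using cinner_commute[of x "c *\<^sub>C y"] cinner_commute[of x y] by (simp add: cinner_scaleC_left)

lemma scaleC_minus_one: "(- 1) *\<^sub>C x = - x"
  using scaleC_of_real[of "-1" x] by simp

lemma cinner_minus_left: "cinner (- x) y = - cinner x y"
  using cinner_scaleC_left[of "- 1" x y] by (simp add: scaleC_minus_one)

lemma cinner_minus_right: "cinner x (- y) = - cinner x y"
  using cinner_scaleC_right[of x "- 1" y] by (simp add: scaleC_minus_one)

lemma cinner_diff_left: "cinner (x - y) z = cinner x z - cinner y z"
  using cinner_add_left[of x "- y" z] by (simp add: cinner_minus_left)

lemma cinner_diff_right: "cinner x (y - z) = cinner x y - cinner x z"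
  using cinner_add_right[of x y "- z"] by (simp add: cinner_minus_right)

lemma cinner_zero_left [simp]: "cinner 0 x = 0"
  using cinner_add_left[of 0 0 x] by simp

lemma cinner_zero_right [simp]: "cinner x 0 = 0"
  using cinner_add_right[of x 0 0] by simp

lemma cinner_eq_zero_commute: "cinner x y = 0 \<longleftrightarrow> cinner y x = 0"
  using cinner_commute[of x y] by simp

lemma cinner_self: "cinner x x = complex_of_real ((norm x)\<^sup>2)"
proof -
  have "sqrt (Re (cinner x x)) \<ge> 0"
    using norm_eq_sqrt_cinner[of x] norm_ge_zero[of x] by simp
  then have "Re (cinner x x) = (norm x)\<^sup>2"
    by (simp add: norm_eq_sqrt_cinner)
  moreover have "Im (cinner x x) = 0"
    using arg_cong[OF cinner_commute[of x x], of Im] by simp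
  ultimately show ?thesis by (simp add: complex_eq_iff)
qed

lemma cinner_self_eq_zero: "cinner x x = 0 \<longleftrightarrow> x = 0"
  by (simp add: cinner_self)

lemma cinner_eqI: "(\<And>x. cinner x y = cinner x z) \<Longrightarrow> y = z"
  using cinner_self_eq_zero[of "y - z"] by (simp add: cinner_diff_right)

lemma norm_diff_square:
  "(norm (x - y))\<^sup>2 = (norm x)\<^sup>2 + (norm y)\<^sup>2 - 2 * Re (cinner x y)"
proof -
  have "cinner (x - y) (x - y) = cinner x x + cinner y y - (cinner x y + cnj (cinner x y))"
    using cinner_commute[of y x] by (simp add: cinner_diff_left cinner_diff_right)
  then have "complex_of_real ((norm (x - y))\<^sup>2)
      = complex_of_real ((norm x)\<^sup>2 + (norm y)\<^sup>2 - 2 * Re (cinner x y))"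
    by (simp add: cinner_self complex_add_cnj)
  then show ?thesis by (simp only: of_real_eq_iff)
qed

lemma norm_scaleC: "norm (c *\<^sub>C x) = cmod c * norm x"
proof -
  have "complex_of_real ((norm (c *\<^sub>C x))\<^sup>2) = (c * cnj c) * complex_of_real ((norm x)\<^sup>2)"
    by (simp only: cinner_self[symmetric] cinner_scaleC_left cinner_scaleC_right mult.assoc mult.left_commute)
  also have "\<dots> = complex_of_real ((cmod c * norm x)\<^sup>2)"
    by (simp only: complex_norm_square[symmetric] of_real_mult[symmetric] power_mult_distrib)
  finally have "(norm (c *\<^sub>C x))\<^sup>2 = (cmod c * norm x)\<^sup>2"
    by (simp only: of_real_eq_iff)
  then show ?thesis by simp
qed

lemma parallelogram_law:
  "(norm (x - y))\<^sup>2 + (norm (x + y))\<^sup>2 = 2 * (norm x)\<^sup>2 + 2 * (norm y)\<^sup>2"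
  for x y :: "'a::complex_hilbert_space"
  using norm_diff_square[of x y] norm_diff_square[of x "- y"] by (simp add: cinner_minus_right)

text \<open>The squared norm of \<^term>\<open>x\<close> after subtracting a multiple of \<^term>\<open>y\<close>. The right-hand side
  is minimal at \<^term>\<open>t = 1 / (norm y)\<^sup>2\<close>; this choice yields both the Cauchy--Schwarz inequality
  and the orthogonality of the residual of a best approximation.\<close>

lemma norm_diff_scaleC_cinner_square:
  "(norm (x - (of_real t * cinner x y) *\<^sub>C y))\<^sup>2
    = (norm x)\<^sup>2 + t * (t * (norm y)\<^sup>2 - 2) * (cmod (cinner x y))\<^sup>2"
proof -
  have "cnj (of_real t * cinner x y) * cinner x y = of_real (t * (cmod (cinner x y))\<^sup>2)"
    using complex_norm_square[of "cinner x y"] by (simp add: mult.commute mult.left_commute)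
  then have "Re (cinner x ((of_real t * cinner x y) *\<^sub>C y)) = t * (cmod (cinner x y))\<^sup>2"
    by (simp only: cinner_scaleC_right Re_complex_of_real)
  then show ?thesis
    by (simp only: norm_diff_square norm_scaleC norm_mult norm_of_real power_mult_distrib power2_abs)
      (simp add: algebra_simps power2_eq_square)
qed

lemma Cauchy_Schwarz_cinner: "cmod (cinner x y) \<le> norm x * norm y"
proof (cases "y = 0")
  case False
  define t where "t = 1 / (norm y)\<^sup>2"
  have "0 \<le> (norm x)\<^sup>2 + t * (t * (norm y)\<^sup>2 - 2) * (cmod (cinner x y))\<^sup>2"
    using norm_diff_scaleC_cinner_square[of x t y] by (metis zero_le_power2)
  also have "\<dots> = (norm x)\<^sup>2 - (cmod (cinner x y))\<^sup>2 / (norm y)\<^sup>2"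
    using False by (simp add: t_def)
  finally have "(cmod (cinner x y))\<^sup>2 \<le> (norm x * norm y)\<^sup>2"
    using False by (simp add: field_simps power_mult_distrib)
  then show ?thesis by (rule power2_le_imp_le) simp
qed simp

lemma bounded_linear_cinner_left: "bounded_linear (\<lambda>x. cinner x y)"
proof (rule bounded_linear_intro[where K = "norm y"])
  show "cinner (r *\<^sub>R x) y = r *\<^sub>R cinner x y" for r x
    by (simp add: scaleC_of_real[of r x, symmetric] cinner_scaleC_left scaleR_conv_of_real)
qed (simp_all add: cinner_add_left Cauchy_Schwarz_cinner)

lemma bounded_linear_scaleC_right: "bounded_linear (\<lambda>x. c *\<^sub>C x)"
proof (rule bounded_linear_intro[where K = "cmod c"])
  show "c *\<^sub>C (r *\<^sub>R x) = r *\<^sub>R (c *\<^sub>C x)" for r x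
    by (simp add: scaleC_of_real[symmetric] scaleC_scaleC mult.commute)
qed (simp_all add: scaleC_add_right norm_scaleC mult.commute)

section \<open>Complex subspaces and orthogonal projections\<close>

text \<open>Complex linear subspaces, not necessarily closed.\<close>

definition csubspace :: "'a::complex_hilbert_space set \<Rightarrow> bool" where
  "csubspace M \<longleftrightarrow> 0 \<in> M \<and> (\<forall>x\<in>M. \<forall>y\<in>M. x + y \<in> M) \<and> (\<forall>c. \<forall>x\<in>M. c *\<^sub>C x \<in> M)"

text \<open>The orthogonal complement of an arbitrary set of vectors.\<close>

definition orth_compl :: "'a::complex_hilbert_space set \<Rightarrow> 'a set" where
  "orth_compl S = {x. \<forall>z\<in>S. cinner x z = 0}"

lemma csubspace_scaleR: "csubspace M \<Longrightarrow> x \<in> M \<Longrightarrow> r *\<^sub>R x \<in> M"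
  by (metis csubspace_def scaleC_of_real)

lemma csubspace_diff: "csubspace M \<Longrightarrow> x \<in> M \<Longrightarrow> y \<in> M \<Longrightarrow> x - y \<in> M"
  using csubspace_scaleR[of M y "- 1"] unfolding csubspace_def
  by (metis scaleR_minus1_left uminus_add_conv_diff add.commute)

lemma csubspace_closure:
  assumes "csubspace M"
  shows "csubspace (closure M)"
proof -
  have "x + y \<in> closure M" if x: "x \<in> closure M" and y: "y \<in> closure M" for x y
  proof -
    obtain f g where "\<forall>k. f k \<in> M" "f \<longlonglongrightarrow> x" "\<forall>k. g k \<in> M" "g \<longlonglongrightarrow> y"
      using x y unfolding closure_sequential by blast
    then have "\<forall>k. f k + g k \<in> M" "(\<lambda>k. f k + g k) \<longlonglongrightarrow> x + y"
      using assms by (auto simp: csubspace_def intro: tendsto_add)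
    then show ?thesis unfolding closure_sequential by (intro exI[of _ "\<lambda>k. f k + g k"]) simp
  qed
  moreover have "c *\<^sub>C x \<in> closure M" if "x \<in> closure M" for c x
  proof -
    have "c *\<^sub>C x \<in> closure ((\<lambda>x. c *\<^sub>C x) ` M)"
      using closure_bounded_linear_image_subset[OF bounded_linear_scaleC_right, of c M] that by blast
    moreover have "(\<lambda>x. c *\<^sub>C x) ` M \<subseteq> M"
      using assms by (auto simp: csubspace_def)
    ultimately show ?thesis using closure_mono by blast
  qed
  moreover have "0 \<in> closure M"
    using assms closure_subset by (auto simp: csubspace_def)
  ultimately show ?thesis by (simp add: csubspace_def)
qed

lemma csubspace_UNIV: "csubspace UNIV"
  by (simp add: csubspace_def)

lemma csubspace_orth_compl: "csubspace (orth_compl S)"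
  by (auto simp: csubspace_def orth_compl_def cinner_add_left cinner_scaleC_left)

lemma orth_compl_closure: "orth_compl (closure S) = orth_compl S"
proof
  show "orth_compl (closure S) \<subseteq> orth_compl S"
    using closure_subset by (fastforce simp: orth_compl_def)
  show "orth_compl S \<subseteq> orth_compl (closure S)"
  proof
    fix x assume "x \<in> orth_compl S"
    then have "S \<subseteq> {z. cinner z x = 0}"
      by (auto simp: orth_compl_def cinner_eq_zero_commute)
    moreover have "closed {z. cinner z x = 0}"
      by (intro closed_Collect_eq linear_continuous_on bounded_linear_cinner_left continuous_intros)
    ultimately have "closure S \<subseteq> {z. cinner z x = 0}" by (rule closure_minimal)
    then show "x \<in> orth_compl (closure S)"
      by (auto simp: orth_compl_def cinner_eq_zero_commute)
  qed
qed

lemma orth_compl_disjoint: "x \<in> M \<Longrightarrow> x \<in> orth_compl M \<Longrightarrow> x = 0"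
  by (auto simp: orth_compl_def cinner_self_eq_zero)

lemma best_approximation_exists:
  fixes M :: "'a::complex_hilbert_space set"
  assumes M: "csubspace M" "closed M"
  shows "\<exists>a\<in>M. \<forall>z\<in>M. norm (x - a) \<le> norm (x - z)"
proof -
  define d where "d = infdist x M"
  have ne: "M \<noteq> {}" using M(1) by (auto simp: csubspace_def)
  have d_le: "d \<le> norm (x - z)" if "z \<in> M" for z
    using infdist_le[OF that, of x] by (simp add: d_def dist_norm)
  have d0: "d \<ge> 0" by (simp add: d_def infdist_nonneg)
  \<comment> \<open>The almost best approximations form a nested sequence of closed sets whose diameters tend
    to zero by the parallelogram law; the best approximation is their common point.\<close>
  define S where "S k = M \<inter> cball x (d + 1 / Suc k)" for k
  have "\<exists>a. \<Inter>(range S) = {a}"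
  proof (rule decreasing_closed_nest_sing)
    show "closed (S k)" for k
      by (simp add: S_def M closed_Int)
    show "S k \<noteq> {}" for k
    proof -
      have "(INF z\<in>M. dist x z) < d + 1 / Suc k"
        using ne by (simp add: d_def infdist_notempty)
      then obtain z where "z \<in> M" "dist x z < d + 1 / Suc k"
        using ne by (subst (asm) cINF_less_iff) auto
      then show ?thesis by (auto simp: S_def intro!: exI[of _ z])
    qed
    show "S k \<subseteq> S m" if "m \<le> k" for m k
    proof -
      have "1 / real (Suc k) \<le> 1 / real (Suc m)" using that by (simp add: frac_le)
      then show ?thesis by (auto simp: S_def)
    qed
    show "\<exists>k. \<forall>y\<in>S k. \<forall>z\<in>S k. dist y z < e" if "e > 0" for e :: real
    proof -
      have "(\<lambda>k. 4 * (d + 1 / Suc k)\<^sup>2 - 4 * d\<^sup>2) \<longlonglongrightarrow> 4 * (d + 0)\<^sup>2 - 4 * d\<^sup>2"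
        by (intro tendsto_intros LIMSEQ_Suc[OF lim_1_over_n])
      moreover have "0 < e\<^sup>2" using that by simp
      ultimately have "\<forall>\<^sub>F k in sequentially. 4 * (d + 1 / Suc k)\<^sup>2 - 4 * d\<^sup>2 < e\<^sup>2"
        by (simp add: order_tendstoD(2))
      then obtain k where k: "4 * (d + 1 / Suc k)\<^sup>2 - 4 * d\<^sup>2 < e\<^sup>2"
        by (auto simp: eventually_sequentially)
      have "dist y z < e" if y: "y \<in> S k" and z: "z \<in> S k" for y z
      proof -
        have yz: "y \<in> M" "z \<in> M" "norm (x - y) \<le> d + 1 / Suc k" "norm (x - z) \<le> d + 1 / Suc k"
          using y z by (auto simp: S_def dist_norm)
        \<comment> \<open>The midpoint of \<^term>\<open>y\<close> and \<^term>\<open>z\<close> lies in \<^term>\<open>M\<close>, hence has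
          distance at least \<^term>\<open>d\<close> from \<^term>\<open>x\<close>.\<close>
        have "(1/2) *\<^sub>R (y + z) \<in> M"
          using M(1) yz(1,2) by (intro csubspace_scaleR) (auto simp: csubspace_def)
        then have "2 * d \<le> 2 * norm (x - (1/2) *\<^sub>R (y + z))"
          using d_le by simp
        also have "\<dots> = norm (2 *\<^sub>R (x - (1/2) *\<^sub>R (y + z)))" by simp
        also have "2 *\<^sub>R (x - (1/2) *\<^sub>R (y + z)) = (x - y) + (x - z)"
          by (simp add: algebra_simps scaleR_2)
        finally have "4 * d\<^sup>2 \<le> (norm ((x - y) + (x - z)))\<^sup>2"
          using d0 power_mono[of "2 * d" _ 2] by (simp add: power_mult_distrib)
        moreover have "(norm (x - y))\<^sup>2 \<le> (d + 1 / Suc k)\<^sup>2" "(norm (x - z))\<^sup>2 \<le> (d + 1 / Suc k)\<^sup>2"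
          using yz(3,4) by (auto intro!: power_mono)
        moreover have "(x - y) - (x - z) = z - y" by simp
        ultimately have "(norm (z - y))\<^sup>2 \<le> 4 * (d + 1 / Suc k)\<^sup>2 - 4 * d\<^sup>2"
          using parallelogram_law[of "x - y" "x - z"] by simp
        then have "(norm (z - y))\<^sup>2 < e\<^sup>2" using k by linarith
        then show ?thesis
          using \<open>e > 0\<close> by (simp add: dist_norm norm_minus_commute power2_less_imp_less)
      qed
      then show ?thesis by blast
    qed
  qed
  then obtain a where a: "a \<in> S k" for k by blast
  have "norm (x - a) \<le> d + 1 / Suc k" for k
    using a[of k] by (simp add: S_def dist_norm)
  then have "norm (x - a) \<le> d + 0"
    by (intro LIMSEQ_le_const[OF tendsto_add[OF tendsto_const LIMSEQ_Suc[OF lim_1_over_n]]]) auto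
  then have "norm (x - a) \<le> norm (x - z)" if "z \<in> M" for z
    using d_le[OF that] by simp
  moreover have "a \<in> M" using a[of 0] by (simp add: S_def)
  ultimately show ?thesis by blast
qed

lemma orthogonal_decomposition_exists:
  assumes M: "csubspace M" "closed M"
  shows "\<exists>a\<in>M. x - a \<in> orth_compl M"
proof -
  obtain a where a: "a \<in> M" and min: "\<forall>z\<in>M. norm (x - a) \<le> norm (x - z)"
    using best_approximation_exists[OF M] by blast
  have "cinner (x - a) z = 0" if z: "z \<in> M" for z
  proof (rule ccontr)
    assume nz: "cinner (x - a) z \<noteq> 0"
    then have z0: "z \<noteq> 0" by auto
    define t where "t = 1 / (norm z)\<^sup>2"
    have "a + (of_real t * cinner (x - a) z) *\<^sub>C z \<in> M"
      using M(1) a z by (auto simp: csubspace_def)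
    then have "(norm (x - a))\<^sup>2 \<le> (norm (x - a - (of_real t * cinner (x - a) z) *\<^sub>C z))\<^sup>2"
      using min by (intro power_mono) (simp_all add: diff_diff_eq)
    then have "0 \<le> t * (t * (norm z)\<^sup>2 - 2) * (cmod (cinner (x - a) z))\<^sup>2"
      by (simp add: norm_diff_scaleC_cinner_square)
    then show False
      using nz z0 by (simp add: t_def divide_le_0_iff)
  qed
  then show ?thesis using a by (auto simp: orth_compl_def)
qed

lemma orth_proj_eqI:
  assumes "csubspace M" "y \<in> M" "x - y \<in> orth_compl M"
  shows "orth_proj M x = y"
  unfolding orth_proj_def
proof (rule the_equality)
  show "y \<in> M \<and> (\<forall>z\<in>M. cinner (x - y) z = 0)"
    using assms by (simp add: orth_compl_def)
  fix w assume w: "w \<in> M \<and> (\<forall>z\<in>M. cinner (x - w) z = 0)"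
  then have "x - w \<in> orth_compl M" by (simp add: orth_compl_def)
  then have "(x - y) - (x - w) \<in> orth_compl M"
    using assms csubspace_orth_compl csubspace_diff by blast
  then have "w - y \<in> orth_compl M" by simp
  moreover have "w - y \<in> M" using assms w csubspace_diff by blast
  ultimately show "w = y" using orth_compl_disjoint by fastforce
qed

lemma orth_proj_works:
  assumes "csubspace M" "closed M"
  shows "orth_proj M x \<in> M" "x - orth_proj M x \<in> orth_compl M"
proof -
  obtain a where "a \<in> M" "x - a \<in> orth_compl M"
    using orthogonal_decomposition_exists[OF assms] by blast
  moreover from this have "orth_proj M x = a" by (rule orth_proj_eqI[OF assms(1)])
  ultimately show "orth_proj M x \<in> M" "x - orth_proj M x \<in> orth_compl M" by auto
qed

lemma orth_proj_mem: "csubspace M \<Longrightarrow> x \<in> M \<Longrightarrow> orth_proj M x = x"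
  by (rule orth_proj_eqI) (auto simp: orth_compl_def)

lemma orth_proj_compl_mem: "csubspace M \<Longrightarrow> x \<in> orth_compl M \<Longrightarrow> orth_proj M x = 0"
  by (rule orth_proj_eqI) (auto simp: csubspace_def)

lemma orth_proj_orth_compl:
  assumes "csubspace M" "closed M"
  shows "orth_proj (orth_compl M) x = x - orth_proj M x"
proof (rule orth_proj_eqI[OF csubspace_orth_compl])
  show "x - orth_proj M x \<in> orth_compl M" by (rule orth_proj_works[OF assms])
  show "x - (x - orth_proj M x) \<in> orth_compl (orth_compl M)"
    using orth_proj_works(1)[OF assms, of x]
    by (auto simp: orth_compl_def cinner_eq_zero_commute[of "orth_proj M x"])
qed

lemma orth_compl_orth_compl:
  assumes "csubspace M" "closed M"
  shows "orth_compl (orth_compl M) = M"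
proof
  show "M \<subseteq> orth_compl (orth_compl M)"
    using cinner_eq_zero_commute by (fastforce simp: orth_compl_def)
  show "orth_compl (orth_compl M) \<subseteq> M"
  proof
    fix x assume x: "x \<in> orth_compl (orth_compl M)"
    note proj = orth_proj_works[OF assms, of x]
    have "orth_proj M x \<in> orth_compl (orth_compl M)"
      using proj(1) \<open>M \<subseteq> orth_compl (orth_compl M)\<close> by blast
    then have "x - orth_proj M x \<in> orth_compl (orth_compl M)"
      using x csubspace_diff[OF csubspace_orth_compl] by blast
    then have "x - orth_proj M x = 0" using proj(2) orth_compl_disjoint by blast
    then show "x \<in> M" using proj(1) by simp
  qed
qed

section \<open>Adjoints\<close>

lemma Riesz_representation:
  fixes f :: "'a::complex_hilbert_space \<Rightarrow> complex"
  assumes f: "bounded_linear f" "\<And>c x. f (c *\<^sub>C x) = c * f x"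
  shows "\<exists>y. \<forall>x. f x = cinner x y"
proof (cases "\<forall>x. f x = 0")
  case True
  then show ?thesis by (intro exI[of _ 0]) simp
next
  case False
  interpret bounded_linear f by (rule f)
  let ?K = "{x. f x = 0}"
  have K: "csubspace ?K" "closed ?K"
    by (auto simp: csubspace_def add f zero
        intro!: closed_Collect_eq linear_continuous_on continuous_intros)
  obtain x0 where x0: "f x0 \<noteq> 0" using False by blast
  \<comment> \<open>The kernel has codimension one, so a vector orthogonal to it represents the functional up to
    a scalar.\<close>
  define u where "u = x0 - orth_proj ?K x0"
  have u: "u \<in> orth_compl ?K" and fu: "f u \<noteq> 0"
    using orth_proj_works[OF K, of x0] x0 by (auto simp: u_def diff)
  then have u0: "u \<noteq> 0" using zero by auto
  have "f x = cinner x (cnj (f u / cinner u u) *\<^sub>C u)" for x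
  proof -
    have "f u *\<^sub>C x - f x *\<^sub>C u \<in> ?K" by (simp add: diff f)
    then have "cinner (f u *\<^sub>C x - f x *\<^sub>C u) u = 0"
      using u unfolding orth_compl_def cinner_eq_zero_commute[of _ u] by blast
    then show ?thesis
      using u0 by (simp add: cinner_diff_left cinner_scaleC_left cinner_scaleC_right
          cinner_self_eq_zero field_simps)
  qed
  then show ?thesis by blast
qed

lemma adjoint_on_eqI:
  assumes M: "csubspace M" and y: "y \<in> M" and z: "z \<in> M"
    and eq: "\<And>x. x \<in> M \<Longrightarrow> cinner (T x) y = cinner x z"
  shows "adjoint_on M T y = z"
proof -
  have "(THE z. z \<in> M \<and> (\<forall>x\<in>M. cinner (T x) y = cinner x z)) = z"
  proof (rule the_equality)
    show "z \<in> M \<and> (\<forall>x\<in>M. cinner (T x) y = cinner x z)" using z eq by simp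
    fix w assume w: "w \<in> M \<and> (\<forall>x\<in>M. cinner (T x) y = cinner x w)"
    then have "w - z \<in> M" using csubspace_diff[OF M] z by simp
    then have "cinner (w - z) w = cinner (w - z) z"
      using w eq[of "w - z"] by simp
    then have "cinner (w - z) (w - z) = 0" by (simp add: cinner_diff_right)
    then show "w = z" by (simp add: cinner_self_eq_zero)
  qed
  then show ?thesis using y by (simp add: adjoint_on_def)
qed

lemma cinner_adjoint_op:
  assumes "bounded_clinear T"
  shows "cinner (T x) y = cinner x (adjoint_op T y)"
proof -
  have T: "bounded_linear T" "\<And>c x. T (c *\<^sub>C x) = c *\<^sub>C T x"
    using assms by (auto simp: bounded_clinear_def)
  have "\<exists>z. \<forall>x. cinner (T x) y = cinner x z"
  proof (rule Riesz_representation)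
    show "bounded_linear (\<lambda>x. cinner (T x) y)"
      by (rule bounded_linear_compose[OF bounded_linear_cinner_left T(1)])
  qed (simp add: T(2) cinner_scaleC_left)
  then obtain z where z: "cinner (T x) y = cinner x z" for x by blast
  then have "adjoint_op T y = z" by (simp add: adjoint_on_eqI csubspace_UNIV)
  then show ?thesis by (simp only: z)
qed

lemma cinner_adjoint_op_left:
  assumes "bounded_clinear T"
  shows "cinner (adjoint_op T x) y = cinner x (T y)"
proof -
  have "cinner (adjoint_op T x) y = cnj (cinner y (adjoint_op T x))" by (rule cinner_commute)
  also have "\<dots> = cnj (cinner (T y) x)" by (simp only: cinner_adjoint_op[OF assms])
  also have "\<dots> = cinner x (T y)" by (rule cinner_commute[symmetric])
  finally show ?thesis .
qed

lemma bounded_linear_adjoint_op: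
  assumes T: "bounded_clinear T"
  shows "bounded_linear (adjoint_op T)"
proof -
  obtain K where K: "norm (T x) \<le> norm x * K" for x
    using T bounded_linear.bounded[of T] unfolding bounded_clinear_def by blast
  show ?thesis
  proof (rule bounded_linear_intro[where K = K])
    show "adjoint_op T (x + y) = adjoint_op T x + adjoint_op T y" for x y
      by (rule cinner_eqI) (simp add: cinner_adjoint_op[OF T, symmetric] cinner_add_right)
    show "adjoint_op T (r *\<^sub>R x) = r *\<^sub>R adjoint_op T x" for r x
      by (rule cinner_eqI) (simp add: cinner_adjoint_op[OF T, symmetric] cinner_scaleC_right
          scaleC_of_real[symmetric])
    show "norm (adjoint_op T y) \<le> norm y * K" for y
    proof (cases "adjoint_op T y = 0")
      case True
      moreover have "0 \<le> norm y * K" using K[of y] norm_ge_zero order_trans by blast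
      ultimately show ?thesis by simp
    next
      case False
      have "(norm (adjoint_op T y))\<^sup>2 = cmod (cinner (adjoint_op T y) (adjoint_op T y))"
        by (simp only: cinner_self norm_of_real abs_power2)
      also have "\<dots> = cmod (cinner (T (adjoint_op T y)) y)"
        by (simp add: cinner_adjoint_op[OF T])
      also have "\<dots> \<le> norm (T (adjoint_op T y)) * norm y" by (rule Cauchy_Schwarz_cinner)
      also have "\<dots> \<le> (norm (adjoint_op T y) * K) * norm y"
        using K by (intro mult_right_mono) auto
      finally show ?thesis using False by (simp add: power2_eq_square mult.commute mult.left_commute)
    qed
  qed
qed

lemma bounded_clinear_funpow:
  assumes "bounded_clinear T"
  shows "bounded_clinear (T ^^ k)"
proof (induction k)
  case 0
  then show ?case by (simp add: bounded_clinear_def bounded_linear_ident id_def)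
next
  case (Suc k)
  then show ?case
    using assms bounded_linear_compose[of T "T ^^ k"] by (simp add: bounded_clinear_def comp_def)
qed

lemma cinner_adjoint_op_funpow:
  assumes "bounded_clinear T"
  shows "cinner ((T ^^ k) x) y = cinner x ((adjoint_op T ^^ k) y)"
  by (induction k arbitrary: y)
    (simp_all add: cinner_adjoint_op[OF assms] funpow_swap1[of "adjoint_op T"])

lemma adjoint_op_funpow:
  assumes "bounded_clinear T"
  shows "adjoint_op (T ^^ k) = adjoint_op T ^^ k"
  by (rule ext, rule adjoint_on_eqI)
    (simp_all add: csubspace_UNIV cinner_adjoint_op_funpow[OF assms])

lemma csubspace_range:
  assumes "bounded_clinear T"
  shows "csubspace (range T)"
proof -
  have T: "linear T" "\<And>c x. T (c *\<^sub>C x) = c *\<^sub>C T x"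
    using assms by (auto simp: bounded_clinear_def bounded_linear.linear)
  have "T x + T y \<in> range T" "c *\<^sub>C T x \<in> range T" for c x y
    by (simp_all only: T(2)[symmetric] linear_add[OF T(1), symmetric] rangeI)
  moreover have "0 \<in> range T" using linear_0[OF T(1)] rangeI[of T 0] by simp
  ultimately show ?thesis by (auto simp: csubspace_def)
qed

lemma ker_adjoint_op_funpow:
  assumes "bounded_clinear T"
  shows "ker (adjoint_op T ^^ k) = orth_compl (closure (range (T ^^ k)))"
proof -
  have *: "cinner x ((T ^^ k) y) = 0 \<longleftrightarrow> cinner y ((adjoint_op T ^^ k) x) = 0" for x y
    unfolding cinner_adjoint_op_funpow[OF assms, symmetric] by (rule cinner_eq_zero_commute)
  show ?thesis
  proof (intro set_eqI iffI)
    fix x assume "x \<in> ker (adjoint_op T ^^ k)"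
    then show "x \<in> orth_compl (closure (range (T ^^ k)))"
      unfolding orth_compl_closure by (simp add: ker_def orth_compl_def *)
  next
    fix x assume "x \<in> orth_compl (closure (range (T ^^ k)))"
    then have "cinner y ((adjoint_op T ^^ k) x) = 0" for y
      unfolding orth_compl_closure by (simp add: orth_compl_def *)
    then show "x \<in> ker (adjoint_op T ^^ k)"
      unfolding ker_def using cinner_self_eq_zero by blast
  qed
qed

text \<open>A normal operator has the same kernel as its adjoint, since \<open>\<parallel>T x\<parallel> = \<parallel>T\<^sup>* x\<parallel>\<close>.\<close>

lemma normal_op_ker_adjoint:
  assumes T: "bounded_clinear T" and "normal_op T"
  shows "ker (adjoint_op T) = ker T"
proof -
  have "T (adjoint_op T x) = adjoint_op T (T x)" for x
    using assms(2) by (simp add: normal_on_def commutator_def)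
  then have "cinner (adjoint_op T x) (adjoint_op T x) = cinner (T x) (T x)" for x
    by (simp only: cinner_adjoint_op[OF T] cinner_adjoint_op_left[OF T])
  then have "adjoint_op T x = 0 \<longleftrightarrow> T x = 0" for x
    using cinner_self_eq_zero[of "adjoint_op T x"] cinner_self_eq_zero[of "T x"] by simp
  then show ?thesis by (simp add: ker_def)
qed

section \<open>Power quasinormal operators\<close>

text \<open>A fixed operator \<open>T\<close> that is \<open>n\<close>-power quasinormal on the whole space. Here \<open>L\<close> is given
  as an orthogonal complement; \<open>mem_L_iff\<close> identifies it with the kernel of \<open>A\<^sup>n\<close>.\<close>

locale power_quasinormal_operator =
  fixes T :: "'a::complex_hilbert_space \<Rightarrow> 'a" and n :: nat
  assumes n: "n \<ge> 1"
    and T: "bounded_clinear T"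
    and quasinormal: "power_quasinormal n T"
begin

abbreviation A :: "'a \<Rightarrow> 'a" where "A \<equiv> adjoint_op T"
abbreviation M :: "'a set" where "M \<equiv> closure (range (T ^^ n))"
abbreviation L :: "'a set" where "L \<equiv> orth_compl M"

lemma bounded_linear_T: "bounded_linear T"
  using T by (simp add: bounded_clinear_def)

lemma bounded_linear_Tn: "bounded_linear (T ^^ k)"
  using bounded_clinear_funpow[OF T] by (simp add: bounded_clinear_def)

lemmas bounded_linear_A = bounded_linear_adjoint_op[OF T]
lemmas T_zero = linear_0[OF bounded_linear.linear[OF bounded_linear_T]]
lemmas T_diff = linear_diff[OF bounded_linear.linear[OF bounded_linear_T]]
lemmas Tn_zero = linear_0[OF bounded_linear.linear[OF bounded_linear_Tn]]
lemmas Tn_diff = linear_diff[OF bounded_linear.linear[OF bounded_linear_Tn]]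
lemmas A_zero = linear_0[OF bounded_linear.linear[OF bounded_linear_A]]

lemma csubspace_M: "csubspace M"
  by (intro csubspace_closure csubspace_range bounded_clinear_funpow T)

lemmas proj_M = orth_proj_works[OF csubspace_M closed_closure]

lemma Tn_mem_M: "(T ^^ n) x \<in> M"
  by (rule subsetD[OF closure_subset]) (rule rangeI)

lemma mem_L_iff: "x \<in> L \<longleftrightarrow> (A ^^ n) x = 0"
  unfolding ker_adjoint_op_funpow[OF T, symmetric] by (simp add: ker_def)

lemma Tn_AT_commute: "(T ^^ n) (A (T x)) = A (T ((T ^^ n) x))"
  using quasinormal by (simp add: power_quasinormal_on_def commutator_def)

lemma M_invariant:
  assumes "bounded_linear S" and "\<And>x. S ((T ^^ n) x) = (T ^^ n) (S x)" and "x \<in> M"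
  shows "S x \<in> M"
proof -
  have "S ` range (T ^^ n) \<subseteq> range (T ^^ n)" using assms(2) by auto
  then have "S ` M \<subseteq> M"
    using closure_bounded_linear_image_subset[OF assms(1), of "range (T ^^ n)"] closure_mono by blast
  then show ?thesis using assms(3) by blast
qed

lemma T_mem_M: "x \<in> M \<Longrightarrow> T x \<in> M"
  by (rule M_invariant[OF bounded_linear_T]) (simp_all add: funpow_swap1)

lemma AT_mem_M: "x \<in> M \<Longrightarrow> A (T x) \<in> M"
  by (rule M_invariant[OF bounded_linear_compose[OF bounded_linear_A bounded_linear_T]])
    (simp_all add: Tn_AT_commute)

text \<open>The kernel of \<open>T\<close> is that of \<open>A T\<close>, which commutes with \<open>T\<^sup>n\<close>; hence \<open>A\<^sup>n\<close> maps the kernel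
  of \<open>T\<close> into itself, and vanishes there because \<open>T\<^sup>n\<close> does (as \<open>n \<ge> 1\<close>).\<close>

lemma ker_T_subset_L:
  assumes "T x = 0"
  shows "x \<in> L"
proof -
  let ?y = "(A ^^ n) x"
  have "cinner (T ?y) (T ?y) = cinner (A (T ?y)) ?y"
    by (simp only: cinner_adjoint_op_left[OF T])
  also have "\<dots> = cinner ((T ^^ n) (A (T ?y))) x"
    by (simp only: cinner_adjoint_op_funpow[OF T])
  also have "\<dots> = cinner (A (T ((T ^^ n) ?y))) x"
    by (simp only: Tn_AT_commute)
  also have "\<dots> = 0"
    by (simp add: cinner_adjoint_op_left[OF T] assms)
  finally have "T ?y = 0" by (simp add: cinner_self_eq_zero)
  moreover obtain m where "n = Suc m" using n by (cases n) auto
  ultimately have "(T ^^ n) ?y = 0" by (simp add: funpow_Suc_right Tn_zero del: funpow.simps)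
  then have "cinner ?y ?y = 0"
    using cinner_adjoint_op_funpow[OF T, of n ?y x] by simp
  then show ?thesis by (simp add: mem_L_iff cinner_self_eq_zero)
qed

lemma T_eq_zero_M: "x \<in> M \<Longrightarrow> T x = 0 \<Longrightarrow> x = 0"
  using ker_T_subset_L orth_compl_disjoint by blast

lemma inj_on_T_M: "inj_on T M"
proof (rule inj_onI)
  fix x y assume "x \<in> M" "y \<in> M" "T x = T y"
  then have "x - y \<in> M" "T (x - y) = 0" by (simp_all add: csubspace_diff[OF csubspace_M] T_diff)
  then show "x = y" using T_eq_zero_M by fastforce
qed

lemma Tn_eq_zero_M:
  assumes "x \<in> M" "(T ^^ k) x = 0"
  shows "x = 0"
proof -
  have M: "(T ^^ k) x \<in> M" for k by (induction k) (simp_all add: assms(1) T_mem_M)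
  show ?thesis using assms(2)
    by (induction k) (use M T_eq_zero_M in auto)
qed

text \<open>The off-diagonal block maps into the orthogonal complement of the range of the diagonal block
  on \<open>M\<close>.\<close>

lemma off_diagonal_orthogonal:
  assumes y: "y \<in> L" and m: "m \<in> M"
  shows "cinner (orth_proj M (T y)) (T m) = 0"
proof -
  have "cinner (T y) (T m) = cinner y (A (T m))" by (rule cinner_adjoint_op[OF T])
  also have "\<dots> = 0" using y AT_mem_M[OF m] by (simp add: orth_compl_def)
  finally have "cinner (T y) (T m) = 0" .
  moreover have "cinner (T y - orth_proj M (T y)) (T m) = 0"
    using proj_M(2)[of "T y"] T_mem_M[OF m] by (simp add: orth_compl_def)
  ultimately show ?thesis by (simp add: cinner_diff_left)
qed

lemma off_diagonal_zero_iff: "orth_proj M (T y) = 0 \<longleftrightarrow> T y \<in> L"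
  using proj_M(2)[of "T y"] orth_proj_compl_mem[OF csubspace_M, of "T y"] by auto

text \<open>Each of the next two lemmas shows that the off-diagonal block vanishes.\<close>

lemma L_invariant_if_range_stable:
  assumes "M = closure (range (T ^^ Suc n))" and y: "y \<in> L"
  shows "T y \<in> L"
proof -
  have "orth_proj M (T y) \<in> orth_compl (range (T ^^ Suc n))"
    using off_diagonal_orthogonal[OF y Tn_mem_M] by (simp add: orth_compl_def)
  then have "orth_proj M (T y) \<in> L"
    by (simp only: assms(1) orth_compl_closure)
  then have "orth_proj M (T y) = 0" using proj_M(1) orth_compl_disjoint by blast
  then show ?thesis by (simp add: off_diagonal_zero_iff)
qed

lemma L_invariant_if_L_subset_ker:
  assumes L: "L \<subseteq> ker (T ^^ n)" and y: "y \<in> L"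
  shows "T y \<in> L"
proof -
  have "(T ^^ n) (T y) = T ((T ^^ n) y)" by (simp add: funpow_swap1)
  also have "\<dots> = 0" using L y T_zero by (auto simp: ker_def)
  finally have "(T ^^ n) (T y) = 0" .
  moreover have "(T ^^ n) (T y - orth_proj M (T y)) = 0"
    using L proj_M(2) by (auto simp: ker_def)
  ultimately have "(T ^^ n) (orth_proj M (T y)) = 0" by (simp add: Tn_diff)
  then have "orth_proj M (T y) = 0" using proj_M(1) Tn_eq_zero_M by blast
  then show ?thesis by (simp add: off_diagonal_zero_iff)
qed

text \<open>Quasinormality says that \<open>T\<^sup>n\<close> and \<open>A\<close> commute on the range of \<open>T\<close>, whose closure
  contains \<open>M\<close>.\<close>

lemma Tn_A_commute_M:
  assumes "x \<in> M"
  shows "(T ^^ n) (A x) = A ((T ^^ n) x)"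
proof -
  obtain m where "n = Suc m" using n by (cases n) auto
  then have "range (T ^^ n) \<subseteq> range T" by auto
  then have "range (T ^^ n) \<subseteq> {x. (T ^^ n) (A x) = A ((T ^^ n) x)}"
    using Tn_AT_commute by (auto simp: funpow_swap1)
  moreover have "closed {x. (T ^^ n) (A x) = A ((T ^^ n) x)}"
    by (intro closed_Collect_eq linear_continuous_on
        bounded_linear_compose[OF bounded_linear_Tn bounded_linear_A]
        bounded_linear_compose[OF bounded_linear_A bounded_linear_Tn])
  ultimately show ?thesis using assms closure_minimal by blast
qed

text \<open>The consequences of \<open>M\<close> being a reducing subspace.\<close>

context
  assumes L_invariant: "\<And>y. y \<in> L \<Longrightarrow> T y \<in> L"
begin

lemma Tn_zero_on_L:
  assumes "y \<in> L"
  shows "(T ^^ n) y = 0"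
proof -
  have "(T ^^ k) y \<in> L" for k by (induction k) (simp_all add: assms L_invariant)
  then show ?thesis using Tn_mem_M orth_compl_disjoint by blast
qed

lemma A_mem_M:
  assumes "x \<in> M"
  shows "A x \<in> M"
proof -
  have "cinner (A x) y = 0" if "y \<in> L" for y
    using L_invariant[OF that] assms cinner_eq_zero_commute[of x "T y"]
    by (simp add: cinner_adjoint_op_left[OF T] orth_compl_def)
  then have "A x \<in> orth_compl L" by (simp add: orth_compl_def)
  then show ?thesis by (simp add: orth_compl_orth_compl[OF csubspace_M])
qed

lemma Tn_normal: "normal_op (T ^^ n)"
proof -
  have A_M: "(A ^^ k) x \<in> M" if "x \<in> M" for k x
    by (induction k) (simp_all add: that A_mem_M)
  have M: "(T ^^ n) ((A ^^ k) x) = (A ^^ k) ((T ^^ n) x)" if "x \<in> M" for k x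
    by (induction k) (simp_all add: Tn_A_commute_M A_M that)
  have A_linear: "linear (A ^^ n)"
    by (metis adjoint_op_funpow[OF T] bounded_linear_adjoint_op[OF bounded_clinear_funpow[OF T]]
        bounded_linear.linear)
  have "(T ^^ n) ((A ^^ n) x) = (A ^^ n) ((T ^^ n) x)" for x
  proof -
    let ?p = "orth_proj M x"
    have "(A ^^ n) (x - ?p) = 0" "(T ^^ n) (x - ?p) = 0"
      using proj_M(2)[of x] mem_L_iff Tn_zero_on_L by blast+
    then have "(A ^^ n) x = (A ^^ n) ?p" "(T ^^ n) x = (T ^^ n) ?p"
      by (simp_all add: Tn_diff linear_diff[OF A_linear])
    then show ?thesis using M[OF proj_M(1)] by simp
  qed
  then show ?thesis by (simp add: normal_on_def commutator_def adjoint_op_funpow[OF T])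
qed

lemma restriction_power_normal: "power_normal_on M n (restrict T M)"
proof -
  have pow: "(restrict T M ^^ k) x = (T ^^ k) x \<and> (T ^^ k) x \<in> M" if "x \<in> M" for k x
    by (induction k) (simp_all add: that T_mem_M)
  have adj: "adjoint_on M (restrict T M) x = A x" if "x \<in> M" for x
    by (rule adjoint_on_eqI[OF csubspace_M that A_mem_M[OF that]]) (simp add: cinner_adjoint_op[OF T])
  show ?thesis
    by (simp add: power_normal_on_def commutator_def adj pow A_mem_M Tn_A_commute_M)
qed

text \<open>A vector of \<open>M\<close> orthogonal to the range of \<open>T\<^bsup>n+1\<^esup>\<close> is annihilated by \<open>A\<close>, since
  its image under \<open>A\<close> lies both in \<open>M\<close> and in \<open>L\<close>; since \<open>n \<ge> 1\<close>, it then lies in \<open>L\<close> itself.\<close>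

lemma range_stable: "M = closure (range (T ^^ Suc n))"
proof
  let ?M' = "closure (range (T ^^ Suc n))"
  have "range (T ^^ Suc n) \<subseteq> range (T ^^ n)" by (auto simp: funpow_swap1)
  then show sub: "?M' \<subseteq> M" by (rule closure_mono)
  have M': "csubspace ?M'" by (intro csubspace_closure csubspace_range bounded_clinear_funpow T)
  show "M \<subseteq> ?M'"
  proof
    fix x assume x: "x \<in> M"
    define z where "z = x - orth_proj ?M' x"
    note proj = orth_proj_works[OF M' closed_closure, of x]
    have zM: "z \<in> M" unfolding z_def using x proj(1) sub csubspace_diff[OF csubspace_M] by blast
    have z: "z \<in> orth_compl (range (T ^^ Suc n))"
      using proj(2) unfolding z_def orth_compl_closure .
    then have "A z \<in> orth_compl (range (T ^^ n))"
      by (simp add: orth_compl_def cinner_adjoint_op_left[OF T])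
    then have "A z \<in> L" by (simp only: orth_compl_closure)
    then have "A z = 0" by (rule orth_compl_disjoint[OF A_mem_M[OF zM]])
    moreover obtain m where "n = Suc m" using n by (cases n) auto
    moreover have "(A ^^ m) 0 = 0" for m by (induction m) (simp_all add: A_zero)
    ultimately have "(A ^^ n) z = 0" by (simp add: funpow_Suc_right del: funpow.simps)
    then have "z \<in> L" by (simp only: mem_L_iff)
    then have "z = 0" using zM orth_compl_disjoint by blast
    then show "x \<in> ?M'" using proj(1) by (simp add: z_def)
  qed
qed

lemma restriction_quasiaffinity: "quasiaffinity_on M (restrict T M)"
proof -
  have "range (T ^^ Suc n) \<subseteq> T ` M" using Tn_mem_M by auto
  then have "M \<subseteq> closure (T ` M)" using range_stable closure_mono by blast
  moreover have "closure (T ` M) \<subseteq> M" using T_mem_M by (intro closure_minimal) auto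
  ultimately show ?thesis
    using inj_on_T_M by (auto simp: quasiaffinity_on_def inj_on_def)
qed

end

lemma L_invariant_if_Tn_normal:
  assumes "normal_op (T ^^ n)" "y \<in> L"
  shows "T y \<in> L"
proof -
  have "L = ker (T ^^ n)"
    using normal_op_ker_adjoint[OF bounded_clinear_funpow[OF T] assms(1)]
    by (simp only: adjoint_op_funpow[OF T] ker_adjoint_op_funpow[OF T])
  then show ?thesis using L_invariant_if_L_subset_ker assms(2) by blast
qed

end

section \<open>The equivalence\<close>

theorem theorem2p5:
  fixes T Tt X N :: "'a::complex_hilbert_space \<Rightarrow> 'a" and n :: nat and M L :: "'a set"
  assumes n: "n \<ge> 1"
    and T: "bounded_clinear T" "power_quasinormal n T"
    and M: "M = closure (range (T ^^ n))"
    and L: "L = ker (adjoint_op T ^^ n)"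
    and Tt: "Tt = (\<lambda>x\<in>M. T x)"
    and X: "X = (\<lambda>x\<in>L. orth_proj M (T x))"
    and N: "N = (\<lambda>x\<in>L. orth_proj L (T x))"
  shows "T = block_op M L Tt X (\<lambda>x\<in>M. 0) N \<and>
    (let i = (closure (range (T ^^ n)) = closure (range (T ^^ (n + 1))));
         ii = (ker (adjoint_op T ^^ n) \<subseteq> ker (T ^^ n));
         iii = (X = (\<lambda>x\<in>L. 0));
         iv = (T = direct_sum_op M L Tt N \<and> power_normal_on M n Tt \<and> quasiaffinity_on M Tt);
         v = normal_op (T ^^ n)
     in (i \<longleftrightarrow> ii) \<and> (i \<longleftrightarrow> iii) \<and> (i \<longleftrightarrow> iv) \<and> (i \<longleftrightarrow> v))"
proof -
  interpret Q: power_quasinormal_operator T n by standard (use n T in auto)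
  have L': "L = orth_compl M" unfolding L M by (rule ker_adjoint_op_funpow[OF T(1)])
  have csM: "csubspace M" "closed M" unfolding M by (rule Q.csubspace_M, rule closed_closure)
  have csL: "csubspace L" unfolding L' by (rule csubspace_orth_compl)
  have projM: "orth_proj M x \<in> M" for x by (rule orth_proj_works[OF csM])
  have projL: "orth_proj L x = x - orth_proj M x" for x
    unfolding L' by (rule orth_proj_orth_compl[OF csM])
  have projL_mem: "orth_proj L x \<in> L" for x
    unfolding projL unfolding L' by (rule orth_proj_works[OF csM])
  have T_split: "T x = T (orth_proj M x) + T (orth_proj L x)" for x
    by (simp add: projL Q.T_diff)
  have block: "T = block_op M L Tt X (\<lambda>x\<in>M. 0) N"
  proof
    fix x
    have "T (orth_proj L x) = orth_proj M (T (orth_proj L x)) + orth_proj L (T (orth_proj L x))"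
      by (simp add: projL)
    then show "T x = block_op M L Tt X (\<lambda>x\<in>M. 0) N x"
      using T_split[of x] by (simp add: block_op_def Tt X N projM projL_mem add.assoc)
  qed
  \<comment> \<open>The condition that \<^term>\<open>M\<close> reduces \<^term>\<open>T\<close>, to which all others are compared.\<close>
  define R where "R \<longleftrightarrow> (\<forall>y\<in>L. T y \<in> L)"
  have inv: "T y \<in> orth_compl (closure (range (T ^^ n)))"
    if R "y \<in> orth_compl (closure (range (T ^^ n)))" for y
    using that by (simp add: R_def L' M)
  have i: "closure (range (T ^^ n)) = closure (range (T ^^ (n + 1))) \<longleftrightarrow> R"
    using Q.L_invariant_if_range_stable Q.range_stable[OF inv] unfolding R_def L' M Suc_eq_plus1
    by blast
  have ii: "ker (adjoint_op T ^^ n) \<subseteq> ker (T ^^ n) \<longleftrightarrow> R"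
  proof
    assume "ker (adjoint_op T ^^ n) \<subseteq> ker (T ^^ n)"
    then have "orth_compl (closure (range (T ^^ n))) \<subseteq> ker (T ^^ n)"
      by (simp only: ker_adjoint_op_funpow[OF T(1)])
    from Q.L_invariant_if_L_subset_ker[OF this] show R
      unfolding R_def L' M by blast
  next
    assume R
    show "ker (adjoint_op T ^^ n) \<subseteq> ker (T ^^ n)"
    proof
      fix x assume "x \<in> ker (adjoint_op T ^^ n)"
      then have "x \<in> orth_compl (closure (range (T ^^ n)))"
        by (simp only: ker_adjoint_op_funpow[OF T(1)])
      then have "(T ^^ n) x = 0" by (rule Q.Tn_zero_on_L[OF inv[OF \<open>R\<close>], rotated])
      then show "x \<in> ker (T ^^ n)" by (simp add: ker_def)
    qed
  qed
  have iii: "X = (\<lambda>x\<in>L. 0) \<longleftrightarrow> R"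
  proof -
    have "X = (\<lambda>x\<in>L. 0) \<longleftrightarrow> (\<forall>y\<in>L. orth_proj M (T y) = 0)"
      by (auto simp: X fun_eq_iff restrict_def)
    then show ?thesis by (simp add: R_def L' M Q.off_diagonal_zero_iff)
  qed
  have iv: "T = direct_sum_op M L Tt N \<and> power_normal_on M n Tt \<and> quasiaffinity_on M Tt \<longleftrightarrow> R"
  proof
    assume asm: "T = direct_sum_op M L Tt N \<and> power_normal_on M n Tt \<and> quasiaffinity_on M Tt"
    have "T y \<in> L" if y: "y \<in> L" for y
    proof -
      have "orth_proj M y = 0" using y orth_proj_compl_mem[OF csM(1)] by (simp add: L')
      moreover have "0 \<in> M" using csM(1) by (simp add: csubspace_def)
      moreover have "T y = Tt (orth_proj M y) + N (orth_proj L y)"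
        using asm by (metis direct_sum_op_def)
      ultimately have "T y = orth_proj L (T y)"
        using y by (simp add: Tt N projL Q.T_zero)
      then show ?thesis using projL_mem by metis
    qed
    then show R by (simp add: R_def)
  next
    assume R
    then have "orth_proj L (T (orth_proj L x)) = T (orth_proj L x)" for x
      using projL_mem orth_proj_mem[OF csL] by (simp add: R_def)
    then have "direct_sum_op M L Tt N x = T (orth_proj M x) + T (orth_proj L x)" for x
      by (simp add: direct_sum_op_def Tt N projM projL_mem)
    then have "T = direct_sum_op M L Tt N"
      by (simp only: fun_eq_iff T_split[symmetric] simp_thms)
    moreover have "power_normal_on M n Tt" "quasiaffinity_on M Tt"
      unfolding Tt M
      by (rule Q.restriction_power_normal, erule inv[OF \<open>R\<close>],
          rule Q.restriction_quasiaffinity, erule inv[OF \<open>R\<close>])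
    ultimately show "T = direct_sum_op M L Tt N \<and> power_normal_on M n Tt \<and> quasiaffinity_on M Tt"
      by blast
  qed
  have v: "normal_op (T ^^ n) \<longleftrightarrow> R"
  proof
    assume "normal_op (T ^^ n)"
    from Q.L_invariant_if_Tn_normal[OF this] show R unfolding R_def L' M by blast
  next
    assume R
    show "normal_op (T ^^ n)" by (rule Q.Tn_normal, erule inv[OF \<open>R\<close>])
  qed
  show ?thesis
    unfolding Let_def i ii iii iv v using block by blast
qed

end
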